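(* Let $\mathcal P(U^{3,n})$ be the matroid polytope of the uniform matroid of rank $3$ on $n$ elements, and let $I$ be a non-negative integer. Then there exists $n(I)\in\mathbb N$ such that for all $n\ge n(I)$ the $h^*$-vector $(h^*_0,\dots,h^*_n)$ of $\mathcal P(U^{3,n})$ satisfies $h^*_0\le h^*_1\le\dots\le h^*_I$.
   Context: The uniform matroid $U^{r,n}$ of rank $r$ on $[n]=\{1,\dots,n\}$ has as bases all $r$-element subsets of $[n]$. Its matroid polytope is $\mathcal P(U^{r,n})=\mathrm{conv}\{e_B: B\subseteq[n],|B|=r\}$, where $e_B=\sum_{i\in B}e_i$. For an integral polytope $\mathcal P$ of dimension $d$ with Ehrhart polynomial $i(\mathcal P,k)=\#(k\mathcal P\cap\mathbb Z^n)$ ($i(\mathcal P,0)=1$), its Ehrhart series can be written as $\sum_{k\ge0}i(\mathcal P,k)t^k=\frac{h^*_0+h^*_1t+\dots+h^*_dt^d}{(1-t)^{d+1}}$; the coefficients $h^*_j$ form the $h^*$-vector (with $h^*_j=0$ for $j>d$). *)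

theory Defs
  imports "HOL-Analysis.Analysis" "HOL-Analysis.Finite_Function_Topology"
    "HOL-Computational_Algebra.Formal_Power_Series"
begin

text \<open>
  The ambient space is the space of finitely supported functions from \<^typ>\<open>nat\<close> to \<^typ>\<open>real\<close>,
  in which R^n is the subspace of vectors supported in \<^term>\<open>{1..n}\<close>. This lets n
  vary within a formula. A polytope in R^n has the same convex hull, dimension, dilates and
  lattice points when it is regarded as a subset of the larger space.
\<close>

type_synonym rvec = "nat \<Rightarrow>\<^sub>0 real"

definition unit_vec :: "nat \<Rightarrow> rvec" where
  "unit_vec i = Poly_Mapping.single i 1"

definition uniform_matroid_bases :: "nat \<Rightarrow> nat \<Rightarrow> nat set set" where
  "uniform_matroid_bases r n = {B. B \<subseteq> {1..n} \<and> card B = r}"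

definition matroid_polytope :: "nat set set \<Rightarrow> rvec set" where
  "matroid_polytope \<B> = convex hull ((\<lambda>B. \<Sum>i\<in>B. unit_vec i) ` \<B>)"

definition lattice_points :: "rvec set" where
  "lattice_points = {x. \<forall>i. Poly_Mapping.lookup x i \<in> \<int>}"

definition ehrhart :: "rvec set \<Rightarrow> nat \<Rightarrow> nat" where
  "ehrhart P k = card (((\<lambda>x. real k *\<^sub>R x) ` P) \<inter> lattice_points)"

definition ehrhart_series :: "rvec set \<Rightarrow> int fps" where
  "ehrhart_series P = Abs_fps (\<lambda>k. int (ehrhart P k))"

text \<open>
  The dimension of the affine hull of a nonempty set, as the dimension of its direction space
  (\<^const>\<open>aff_dim\<close> is restricted to Euclidean spaces).
\<close>

definition polytope_dim :: "rvec set \<Rightarrow> nat" where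
  "polytope_dim P = dim {x - y | x y. x \<in> P \<and> y \<in> P}"

text \<open>
  The numerator of the Ehrhart series over the denominator (1 - t)^(d+1), where d is
  the dimension. As 1 - t is a unit in the ring of power series, the numerator is the
  Ehrhart series times (1 - t)^(d+1).
\<close>

definition h_star :: "rvec set \<Rightarrow> nat \<Rightarrow> int" where
  "h_star P j = fps_nth (ehrhart_series P * (1 - fps_X) ^ (polytope_dim P + 1)) j"

end

theory Submission
  imports Defs "HOL-Real_Asymp.Real_Asymp"
begin

text \<open>
  Let \<open>r \<ge> 2\<close>, and let \<open>d \<le> n\<close> be the dimension of the polytope \<open>P\<close> of the uniform matroid of
  rank \<open>r\<close> on \<open>n\<close> elements. For fixed \<open>k \<ge> 1\<close>, the Ehrhart number \<open>i(P, k)\<close> is of order \<open>n^(r k)\<close>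
  as \<open>n \<rightarrow> \<infinity>\<close>: a lattice point of the \<open>k\<close>-th dilate is a multiset of size \<open>r k\<close> on \<open>n\<close> elements,
  and every set of size \<open>r k\<close> occurs. As the coefficient of \<open>t^m\<close> in \<open>(1 - t)^(d+1)\<close> is at most of
  order \<open>n^m\<close>, the contribution of \<open>i(P, k)\<close> to \<open>h\<^sup>*\<^sub>j\<close> is at most of order \<open>n^(r k + j - k)\<close>, so
  that of \<open>i(P, j)\<close> dominates. Hence \<open>h\<^sup>*\<^sub>j\<close> has order \<open>n^(r j)\<close>, which grows with \<open>j\<close>.
\<close>

subsection \<open>Indicator vectors and matroid polytopes\<close>

lemma lookup_scaleR [simp]:
  "Poly_Mapping.lookup (c *\<^sub>R x) i = c *\<^sub>R Poly_Mapping.lookup x i"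
proof -
  have "finite {i. c *\<^sub>R Poly_Mapping.lookup x i \<noteq> 0}"
    by (rule finite_subset[OF _ finite_keys[of x]]) (auto simp: in_keys_iff)
  then show ?thesis
    by (simp add: scaleR_poly_mapping_def)
qed

lemma lookup_unit_vec: "Poly_Mapping.lookup (unit_vec i) j = (if j = i then 1 else 0)"
  by (simp add: unit_vec_def lookup_single when_def)

definition indicator_vec :: "nat set \<Rightarrow> rvec" where
  "indicator_vec B = (\<Sum>i\<in>B. unit_vec i)"

lemma lookup_indicator_vec:
  "finite B \<Longrightarrow> Poly_Mapping.lookup (indicator_vec B) j = (if j \<in> B then 1 else 0)"
  by (simp add: indicator_vec_def lookup_sum lookup_unit_vec)

lemma inj_on_indicator_vec: "inj_on indicator_vec {B. finite B}"
proof (rule inj_onI)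
  fix A B :: "nat set"
  assume fin: "A \<in> {B. finite B}" "B \<in> {B. finite B}" and eq: "indicator_vec A = indicator_vec B"
  have "j \<in> A \<longleftrightarrow> j \<in> B" for j
    using arg_cong[OF eq, of "\<lambda>x. Poly_Mapping.lookup x j"] fin
    by (simp add: lookup_indicator_vec split: if_splits)
  then show "A = B" by blast
qed

lemma indicator_vec_in_lattice_points: "finite B \<Longrightarrow> indicator_vec B \<in> lattice_points"
  by (simp add: lattice_points_def lookup_indicator_vec)

lemma indicator_vec_Diff:
  assumes "finite S" "B \<subseteq> S"
  shows "indicator_vec S = indicator_vec (S - B) + indicator_vec B"
  unfolding indicator_vec_def by (rule sum.subset_diff[OF assms(2,1)])

lemma matroid_polytope_eq_hull: "matroid_polytope \<B> = convex hull (indicator_vec ` \<B>)"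
  by (simp add: matroid_polytope_def indicator_vec_def)

lemma indicator_vec_in_matroid_polytope: "B \<in> \<B> \<Longrightarrow> indicator_vec B \<in> matroid_polytope \<B>"
  by (simp add: matroid_polytope_eq_hull hull_inc)

lemma convex_matroid_polytope: "convex (matroid_polytope \<B>)"
  by (simp add: matroid_polytope_def)

lemma matroid_polytope_subset_iff:
  "convex S \<Longrightarrow> matroid_polytope \<B> \<subseteq> S \<longleftrightarrow> (\<forall>B\<in>\<B>. indicator_vec B \<in> S)"
  by (simp add: matroid_polytope_eq_hull subset_hull image_subset_iff)

lemma polytope_dim_matroid_polytope_le_card:
  assumes "finite E" "\<B> \<subseteq> Pow E"
  shows "polytope_dim (matroid_polytope \<B>) \<le> card E"
proof -
  let ?V = "span (unit_vec ` E)"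
  have "indicator_vec B \<in> ?V" if "B \<in> \<B>" for B
    unfolding indicator_vec_def using that assms(2) by (intro span_sum span_base) auto
  then have "matroid_polytope \<B> \<subseteq> ?V"
    by (simp add: matroid_polytope_subset_iff subspace_imp_convex)
  then have "{x - y | x y. x \<in> matroid_polytope \<B> \<and> y \<in> matroid_polytope \<B>} \<subseteq> ?V"
    by (auto intro: span_diff)
  then have "polytope_dim (matroid_polytope \<B>) \<le> card (unit_vec ` E)"
    unfolding polytope_dim_def using assms(1) by (intro dim_le_card) auto
  also have "\<dots> \<le> card E"
    using assms(1) by (rule card_image_le)
  finally show ?thesis .
qed

subsection \<open>Lattice points of dilated simplices\<close>

definition dilated_simplex :: "nat set \<Rightarrow> real \<Rightarrow> rvec set" where
  "dilated_simplex E c =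
    {x. Poly_Mapping.keys x \<subseteq> E \<and> (\<forall>i. 0 \<le> Poly_Mapping.lookup x i) \<and>
        (\<Sum>i\<in>E. Poly_Mapping.lookup x i) = c}"

lemma convex_dilated_simplex: "convex (dilated_simplex E c)"
proof (rule convexI)
  fix x y :: rvec and u v :: real
  assume x: "x \<in> dilated_simplex E c" and y: "y \<in> dilated_simplex E c"
    and uv: "0 \<le> u" "0 \<le> v" "u + v = 1"
  have "Poly_Mapping.keys (u *\<^sub>R x + v *\<^sub>R y) \<subseteq> Poly_Mapping.keys x \<union> Poly_Mapping.keys y"
    by (auto simp: in_keys_iff lookup_add)
  moreover have "(\<Sum>i\<in>E. Poly_Mapping.lookup (u *\<^sub>R x + v *\<^sub>R y) i) = u * c + v * c"
    using x y by (simp add: dilated_simplex_def lookup_add sum.distrib flip: sum_distrib_left)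
  moreover have "u * c + v * c = c"
    using uv by (simp flip: distrib_right)
  ultimately show "u *\<^sub>R x + v *\<^sub>R y \<in> dilated_simplex E c"
    using x y uv by (auto simp: dilated_simplex_def lookup_add)
qed

lemma scaleR_in_dilated_simplex:
  assumes "x \<in> dilated_simplex E c" "0 \<le> a"
  shows "a *\<^sub>R x \<in> dilated_simplex E (a * c)"
  using assms by (auto simp: dilated_simplex_def in_keys_iff simp flip: sum_distrib_left)

lemma indicator_vec_in_dilated_simplex:
  assumes "finite E" "B \<subseteq> E"
  shows "indicator_vec B \<in> dilated_simplex E (card B)"
proof -
  have "finite B"
    using assms by (rule rev_finite_subset)
  moreover have "E \<inter> B = B"
    using assms(2) by blast
  ultimately show ?thesis
    using assms
    by (auto simp: dilated_simplex_def in_keys_iff lookup_indicator_vec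
        simp flip: sum.inter_restrict split: if_splits)
qed

lemma dilated_simplex_0:
  assumes "finite E"
  shows "dilated_simplex E 0 = {0}"
proof -
  have "x = 0" if x: "x \<in> dilated_simplex E 0" for x
  proof -
    have "\<forall>i\<in>E. Poly_Mapping.lookup x i = 0"
      using x assms sum_nonneg_eq_0_iff[of E "Poly_Mapping.lookup x"]
      by (simp add: dilated_simplex_def)
    then have "Poly_Mapping.keys x = {}"
      using x by (fastforce simp: dilated_simplex_def in_keys_iff simp del: keys_eq_empty)
    then show ?thesis by simp
  qed
  then show ?thesis
    by (auto simp: dilated_simplex_def)
qed

lemma lattice_points_dilated_simplex_Suc:
  assumes "finite E"
  shows "dilated_simplex E (Suc m) \<inter> lattice_points \<subseteq>
    (\<lambda>(i, y). unit_vec i + y) ` (E \<times> (dilated_simplex E m \<inter> lattice_points))"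
proof
  fix x assume "x \<in> dilated_simplex E (Suc m) \<inter> lattice_points"
  then have keys: "Poly_Mapping.keys x \<subseteq> E" and nonneg: "\<And>i. 0 \<le> Poly_Mapping.lookup x i"
    and total: "(\<Sum>i\<in>E. Poly_Mapping.lookup x i) = real (Suc m)"
    and integral: "\<And>i. Poly_Mapping.lookup x i \<in> \<int>"
    by (auto simp: dilated_simplex_def lattice_points_def)
  obtain i where i: "i \<in> E" "Poly_Mapping.lookup x i \<noteq> 0"
    using total sum.not_neutral_contains_not_neutral[of "Poly_Mapping.lookup x" E] by auto
  have ge_1: "1 \<le> Poly_Mapping.lookup x i"
    using Ints_nonzero_abs_ge1[OF integral i(2)] nonneg[of i] by simp
  have "x - unit_vec i \<in> dilated_simplex E m"
    unfolding dilated_simplex_def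
  proof (intro CollectI conjI allI)
    show "Poly_Mapping.keys (x - unit_vec i) \<subseteq> E"
      using keys i(1) by (auto simp: in_keys_iff lookup_minus lookup_unit_vec split: if_splits)
    show "0 \<le> Poly_Mapping.lookup (x - unit_vec i) j" for j
      using nonneg[of j] ge_1 by (simp add: lookup_minus lookup_unit_vec)
    show "(\<Sum>j\<in>E. Poly_Mapping.lookup (x - unit_vec i) j) = real m"
      using total i(1) assms by (simp add: lookup_minus lookup_unit_vec sum_subtractf)
  qed
  moreover have "x - unit_vec i \<in> lattice_points"
    using integral by (simp add: lattice_points_def lookup_minus lookup_unit_vec)
  moreover have "x = unit_vec i + (x - unit_vec i)"
    by simp
  ultimately show "x \<in> (\<lambda>(i, y). unit_vec i + y) ` (E \<times> (dilated_simplex E m \<inter> lattice_points))"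
    using i(1) by (intro image_eqI[of _ _ "(i, x - unit_vec i)"]) auto
qed

lemma finite_lattice_points_dilated_simplex:
  assumes "finite E"
  shows "finite (dilated_simplex E (real m) \<inter> lattice_points)"
proof (induction m)
  case 0
  then show ?case by (simp add: dilated_simplex_0[OF assms])
next
  case (Suc m)
  then show ?case
    using assms by (intro finite_subset[OF lattice_points_dilated_simplex_Suc]) auto
qed

lemma card_lattice_points_dilated_simplex_le:
  assumes "finite E"
  shows "card (dilated_simplex E (real m) \<inter> lattice_points) \<le> card E ^ m"
proof (induction m)
  case 0
  have "card ({0} \<inter> lattice_points) \<le> card {0 :: rvec}"
    by (rule card_mono) auto
  then show ?case by (simp add: dilated_simplex_0[OF assms])
next
  case (Suc m)
  have fin: "finite (E \<times> (dilated_simplex E m \<inter> lattice_points))"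
    using assms finite_lattice_points_dilated_simplex by blast
  have "card (dilated_simplex E (Suc m) \<inter> lattice_points)
      \<le> card (E \<times> (dilated_simplex E m \<inter> lattice_points))"
    using surj_card_le[OF fin lattice_points_dilated_simplex_Suc[OF assms]] .
  also have "\<dots> \<le> card E ^ Suc m"
    using Suc.IH by (simp add: card_cartesian_product)
  finally show ?case .
qed

subsection \<open>Bounds on the Ehrhart function\<close>

lemma dilate_matroid_polytope_subset:
  assumes "finite E" "\<And>B. B \<in> \<B> \<Longrightarrow> B \<subseteq> E \<and> card B = r"
  shows "(*\<^sub>R) (real k) ` matroid_polytope \<B> \<subseteq> dilated_simplex E (real (r * k))"
proof -
  have "indicator_vec B \<in> dilated_simplex E r" if "B \<in> \<B>" for B
    using indicator_vec_in_dilated_simplex[of E B] assms(1) assms(2)[OF that] by simp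
  then have "matroid_polytope \<B> \<subseteq> dilated_simplex E r"
    by (simp add: matroid_polytope_subset_iff convex_dilated_simplex)
  then have "real k *\<^sub>R x \<in> dilated_simplex E (real k * real r)" if "x \<in> matroid_polytope \<B>" for x
    using that by (intro scaleR_in_dilated_simplex) auto
  then show ?thesis
    by (auto simp: mult.commute)
qed

lemma finite_lattice_points_dilate_matroid_polytope:
  assumes "finite E" "\<And>B. B \<in> \<B> \<Longrightarrow> B \<subseteq> E \<and> card B = r"
  shows "finite ((*\<^sub>R) (real k) ` matroid_polytope \<B> \<inter> lattice_points)"
  using dilate_matroid_polytope_subset[OF assms] finite_lattice_points_dilated_simplex[OF assms(1)]
  by (rule finite_subset[OF Int_mono[OF _ order_refl]])

lemma ehrhart_matroid_polytope_le:
  assumes "finite E" "\<And>B. B \<in> \<B> \<Longrightarrow> B \<subseteq> E \<and> card B = r"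
  shows "ehrhart (matroid_polytope \<B>) k \<le> card E ^ (r * k)"
proof -
  have "ehrhart (matroid_polytope \<B>) k \<le> card (dilated_simplex E (real (r * k)) \<inter> lattice_points)"
    unfolding ehrhart_def
    by (intro card_mono finite_lattice_points_dilated_simplex Int_mono
        dilate_matroid_polytope_subset assms order_refl)
  also have "\<dots> \<le> card E ^ (r * k)"
    using assms(1) by (rule card_lattice_points_dilated_simplex_le)
  finally show ?thesis .
qed

lemma convex_dilate_add:
  fixes S :: "'a::real_vector set"
  assumes "convex S" "0 \<le> a" "0 \<le> b" "x \<in> (*\<^sub>R) a ` S" "y \<in> (*\<^sub>R) b ` S"
  shows "x + y \<in> (*\<^sub>R) (a + b) ` S"
proof (cases "a + b = 0")
  case True
  then have "a = 0" "b = 0"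
    using assms(2,3) by linarith+
  then have "x + y = x" "(*\<^sub>R) a = (*\<^sub>R) (a + b)"
    using assms(5) by auto
  then show ?thesis
    using assms(4) by metis
next
  case False
  obtain p q where p: "p \<in> S" "x = a *\<^sub>R p" and q: "q \<in> S" "y = b *\<^sub>R q"
    using assms(4,5) by blast
  have "(a / (a + b)) *\<^sub>R p + (b / (a + b)) *\<^sub>R q \<in> S"
  proof (rule convexD[OF assms(1) p(1) q(1)])
    show "a / (a + b) + b / (a + b) = 1"
      using False by (simp flip: add_divide_distrib)
  qed (use assms(2,3) in simp_all)
  moreover have "x + y = (a + b) *\<^sub>R ((a / (a + b)) *\<^sub>R p + (b / (a + b)) *\<^sub>R q)"
    using False unfolding scaleR_add_right scaleR_scaleR p(2) q(2) by simp
  ultimately show ?thesis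
    by (rule rev_image_eqI)
qed

abbreviation (input) uniform_polytope :: "nat \<Rightarrow> nat \<Rightarrow> rvec set" where
  "uniform_polytope r n \<equiv> matroid_polytope (uniform_matroid_bases r n)"

lemma indicator_vec_in_dilate_uniform_polytope:
  assumes "k \<ge> 1" "S \<subseteq> {1..n}" "card S = r * k"
  shows "indicator_vec S \<in> (*\<^sub>R) (real k) ` uniform_polytope r n"
  using assms
proof (induction k arbitrary: S rule: nat_induct_at_least)
  case base
  then show ?case
    by (simp add: uniform_matroid_bases_def indicator_vec_in_matroid_polytope)
next
  case (Suc k)
  have "r \<le> card S"
    using Suc.prems by simp
  then obtain B where B: "B \<subseteq> S" "card B = r" "finite B"
    by (rule obtain_subset_with_card_n)
  have "card (S - B) = r * k"
    using B Suc.prems by (simp add: card_Diff_subset)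
  then have "indicator_vec (S - B) \<in> (*\<^sub>R) (real k) ` uniform_polytope r n"
    using Suc.prems by (intro Suc.IH) auto
  moreover have "indicator_vec B \<in> (*\<^sub>R) 1 ` uniform_polytope r n"
    using B Suc.prems
    by (auto simp: uniform_matroid_bases_def intro!: indicator_vec_in_matroid_polytope)
  ultimately have "indicator_vec (S - B) + indicator_vec B
      \<in> (*\<^sub>R) (real k + 1) ` uniform_polytope r n"
    by (intro convex_dilate_add convex_matroid_polytope) auto
  moreover have "finite S"
    using Suc.prems by (auto intro: finite_subset)
  ultimately show ?case
    using indicator_vec_Diff[OF _ B(1)] by (simp add: add.commute)
qed

lemma ehrhart_uniform_polytope_ge:
  assumes "k \<ge> 1"
  shows "n choose (r * k) \<le> ehrhart (uniform_polytope r n) k"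
proof -
  let ?F = "{S. S \<subseteq> {1..n} \<and> card S = r * k}"
  have fin: "?F \<subseteq> {B. finite B}"
    by (auto intro: finite_subset)
  have "n choose (r * k) = card ?F"
    using n_subsets[of "{1..n}" "r * k"] by simp
  also have "\<dots> = card (indicator_vec ` ?F)"
    using card_image[OF inj_on_subset[OF inj_on_indicator_vec fin]] by simp
  also have "\<dots> \<le> ehrhart (uniform_polytope r n) k"
    unfolding ehrhart_def
  proof (rule card_mono)
    show "finite ((*\<^sub>R) (real k) ` uniform_polytope r n \<inter> lattice_points)"
      by (rule finite_lattice_points_dilate_matroid_polytope[of "{1..n}"])
        (auto simp: uniform_matroid_bases_def)
    show "indicator_vec ` ?F \<subseteq> (*\<^sub>R) (real k) ` uniform_polytope r n \<inter> lattice_points"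
    proof (intro image_subsetI IntI)
      fix S assume S: "S \<in> ?F"
      then show "indicator_vec S \<in> (*\<^sub>R) (real k) ` uniform_polytope r n"
        using assms by (intro indicator_vec_in_dilate_uniform_polytope) auto
      show "indicator_vec S \<in> lattice_points"
        using S fin by (intro indicator_vec_in_lattice_points) auto
    qed
  qed
  finally show ?thesis .
qed

subsection \<open>The \<open>h\<^sup>*\<close>-vector and the Ehrhart function\<close>

lemma fps_nth_one_minus_X_power:
  "fps_nth ((1 - fps_X :: 'a::comm_ring_1 fps) ^ d) m = (- 1) ^ m * of_nat (d choose m)"
proof (induction d arbitrary: m)
  case 0
  then show ?case by (cases m) auto
next
  case (Suc d)
  then show ?case by (cases m) (simp_all add: left_diff_distrib distrib_left)
qed

lemma binomial_le_power: "n choose k \<le> n ^ k"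
proof -
  have "n choose k \<le> (n choose k) * fact k"
    by simp
  also have "\<dots> \<le> n ^ k"
    by (rule binomial_fact_pow)
  finally show ?thesis .
qed

lemma h_star_conv_alternating_sum:
  "h_star P j =
    (\<Sum>i\<le>j. int (ehrhart P i) * ((- 1) ^ (j - i) * int (polytope_dim P + 1 choose (j - i))))"
  unfolding h_star_def fps_mult_nth fps_nth_one_minus_X_power ehrhart_series_def fps_nth_Abs_fps
    atLeast0AtMost ..

text \<open>For \<open>j = 0\<close> both sides vanish, so the truncated \<open>j - 1\<close> does no harm.\<close>

lemma abs_h_star_minus_ehrhart_le:
  assumes "r \<ge> 1" and dim: "polytope_dim P < b"
    and growth: "\<And>i. i < j \<Longrightarrow> ehrhart P i \<le> b ^ (r * i)"
  shows "\<bar>h_star P j - int (ehrhart P j)\<bar> \<le> int (j * b ^ (r * (j - 1) + 1))"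
proof -
  let ?d = "polytope_dim P + 1"
  have summand_le: "ehrhart P i * (?d choose (j - i)) \<le> b ^ (r * (j - 1) + 1)"
    if "i < j" for i
  proof -
    obtain m where m: "j = Suc (i + m)"
      using less_imp_Suc_add[OF \<open>i < j\<close>] by blast
    have "?d choose (j - i) \<le> ?d ^ (j - i)"
      by (rule binomial_le_power)
    also have "\<dots> \<le> b ^ (j - i)"
      using dim by (intro power_mono) auto
    finally have "ehrhart P i * (?d choose (j - i)) \<le> b ^ (r * i) * b ^ (j - i)"
      by (intro mult_mono growth[OF that]) auto
    also have "\<dots> = b ^ (r * i + (j - i))"
      by (simp add: power_add)
    also have "\<dots> \<le> b ^ (r * (j - 1) + 1)"
    proof (rule power_increasing)
      show "r * i + (j - i) \<le> r * (j - 1) + 1"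
        using mult_le_mono1[OF assms(1), of m] by (simp add: m distrib_left)
    qed (use dim in simp)
    finally show ?thesis .
  qed
  have "h_star P j - int (ehrhart P j) =
      (\<Sum>i<j. int (ehrhart P i) * ((- 1) ^ (j - i) * int (?d choose (j - i))))"
    by (simp add: h_star_conv_alternating_sum flip: lessThan_Suc_atMost)
  also have "\<bar>\<dots>\<bar> \<le> (\<Sum>i<j. int (ehrhart P i * (?d choose (j - i))))"
    by (rule order_trans[OF sum_abs]) (simp add: abs_mult power_abs)
  also have "\<dots> \<le> (\<Sum>i<j. int (b ^ (r * (j - 1) + 1)))"
    using summand_le by (intro sum_mono) (simp only: of_nat_le_iff lessThan_iff)
  finally show ?thesis by simp
qed

lemma h_star_le_Suc_if_ehrhart_Suc_ge:
  assumes "r \<ge> 1" and dim: "polytope_dim P < b"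
    and growth: "\<And>i. i \<le> j \<Longrightarrow> ehrhart P i \<le> b ^ (r * i)"
    and large: "2 * Suc j * b ^ (r * j + 1) \<le> ehrhart P (Suc j)"
  shows "h_star P j \<le> h_star P (Suc j)"
proof -
  have "ehrhart P j \<le> b ^ (r * j + 1)"
    using dim by (intro order_trans[OF growth[OF order_refl]] power_increasing) auto
  moreover have "j * b ^ (r * (j - 1) + 1) \<le> j * b ^ (r * j + 1)"
    using dim by (intro mult_left_mono power_increasing) auto
  ultimately have "ehrhart P j + j * b ^ (r * (j - 1) + 1) \<le> Suc j * b ^ (r * j + 1)"
    unfolding mult_Suc by (rule add_mono)
  with large have "ehrhart P j + j * b ^ (r * (j - 1) + 1) + Suc j * b ^ (r * j + 1)
      \<le> ehrhart P (Suc j)"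
    by linarith
  then have "int (ehrhart P j) + int (j * b ^ (r * (j - 1) + 1))
      \<le> int (ehrhart P (Suc j)) - int (Suc j * b ^ (r * j + 1))"
    by linarith
  moreover have "\<bar>h_star P j - int (ehrhart P j)\<bar> \<le> int (j * b ^ (r * (j - 1) + 1))"
    by (rule abs_h_star_minus_ehrhart_le[OF assms(1) dim]) (simp add: growth)
  moreover have "\<bar>h_star P (Suc j) - int (ehrhart P (Suc j))\<bar> \<le> int (Suc j * b ^ (r * j + 1))"
    using abs_h_star_minus_ehrhart_le[OF assms(1) dim, of "Suc j"] growth
    by (simp only: less_Suc_eq_le diff_Suc_1)
  ultimately show ?thesis by linarith
qed

subsection \<open>Uniform matroids on many elements\<close>

lemma eventually_const_mult_power_le_binomial:
  fixes a c k :: nat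
  assumes "a < k"
  shows "\<forall>\<^sub>F n in sequentially. c * Suc n ^ a \<le> n choose k"
proof -
  have "\<forall>\<^sub>F n in sequentially. real c * (real n + 1) ^ a \<le> (real n / real k) ^ k"
    using assms by real_asymp
  then show ?thesis
    using eventually_ge_at_top[of k]
  proof eventually_elim
    case (elim n)
    have "real (c * Suc n ^ a) \<le> (real n / real k) ^ k"
      using elim(1) by (simp add: add.commute)
    also have "\<dots> \<le> real (n choose k)"
      using elim(2) by (rule binomial_ge_n_over_k_pow_k)
    finally show ?case
      by (simp only: of_nat_le_iff)
  qed
qed

lemma eventually_h_star_uniform_polytope_le_Suc:
  assumes "r \<ge> 2"
  shows "\<forall>\<^sub>F n in sequentially.
    h_star (uniform_polytope r n) j \<le> h_star (uniform_polytope r n) (Suc j)"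
proof -
  have "r * j + 1 < r * Suc j"
    using assms by simp
  from eventually_const_mult_power_le_binomial[OF this, of "2 * Suc j"] show ?thesis
  proof eventually_elim
    case (elim n)
    let ?P = "uniform_polytope r n"
    have bases: "B \<subseteq> {1..n} \<and> card B = r" if "B \<in> uniform_matroid_bases r n" for B
      using that by (simp add: uniform_matroid_bases_def)
    show ?case
    proof (rule h_star_le_Suc_if_ehrhart_Suc_ge)
      show "polytope_dim ?P < Suc n"
        using polytope_dim_matroid_polytope_le_card[of "{1..n}" "uniform_matroid_bases r n"] bases
        by (auto simp: less_Suc_eq_le)
      show "ehrhart ?P i \<le> Suc n ^ (r * i)" for i
      proof -
        have "ehrhart ?P i \<le> n ^ (r * i)"
          using ehrhart_matroid_polytope_le[OF _ bases] by simp
        also have "\<dots> \<le> Suc n ^ (r * i)"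
          by (intro power_mono) auto
        finally show ?thesis .
      qed
      show "2 * Suc j * Suc n ^ (r * j + 1) \<le> ehrhart ?P (Suc j)"
        using elim ehrhart_uniform_polytope_ge[of "Suc j" n r] by simp
    qed (use assms in simp)
  qed
qed

theorem theorem1p3:
  fixes I :: nat
  shows "\<exists>N::nat. \<forall>n\<ge>N. \<forall>j<I.
    h_star (matroid_polytope (uniform_matroid_bases 3 n)) j
      \<le> h_star (matroid_polytope (uniform_matroid_bases 3 n)) (Suc j)"
proof -
  have "\<forall>\<^sub>F n in sequentially. \<forall>j\<in>{..<I}.
    h_star (uniform_polytope 3 n) j \<le> h_star (uniform_polytope 3 n) (Suc j)"
    by (intro eventually_ball_finite ballI eventually_h_star_uniform_polytope_le_Suc) auto
  then show ?thesis
    by (auto simp: eventually_sequentially)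
qed

end
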